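(* Let $(X,d)$ be a compact metric space, let $\Lambda\subseteq X$ be closed, and let $f\colon X\to X$ be continuous. Assume that at least one of the following properties holds: (1) $f$ has limit shadowing on $\Lambda$; (2) $f$ is topologically hyperbolic; (3) $f$ is expanding on $\Lambda$ and open on $\Lambda$; (4) $f$ has h-shadowing on $\Lambda$ and $f$ is open on a neighbourhood of $\Lambda$. Then for any nonempty closed subset $A\subseteq\Lambda$ the following are equivalent: (a) $A$ has weak incompressibility; (b) $A$ is internally chain transitive; (c) $A=\omega(x_A,f)$ for some $x_A\in X$.
   Context: Throughout, $(X,d)$ is a compact metric space, $f\colon X\to X$ is continuous, and $\mathbb{N}=\{0,1,2,\dots\}$. The $\omega$-limit set of $x\in X$ is $\omega(x,f)=\bigcap_{k=0}^\infty\overline{\{f^n(x):n\ge k\}}$. Pseudo-orbits: a finite or infinite sequence $x_0,x_1,\dots$ in $X$ is an $\varepsilon$-pseudo-orbit ($\varepsilon>0$) if $d(f(x_n),x_{n+1})<\varepsilon$ for all $n\ge 0$ for which $x_{n+1}$ is defined. An infinite sequence $\{x_n\}_{n\in\mathbb{N}}$ is an asymptotic pseudo-orbit if $d(f(x_n),x_{n+1})\to 0$ as $n\to\infty$. A set $A\subseteq X$ is internally chain transitive if for all $x,y\in A$ and every $\varepsilon>0$ there is an $\varepsilon$-pseudo-orbit $x_0=x,x_1,\dots,x_m=y$ with $m\geq 1$ and all $x_i\in A$. A set $A\subseteq X$ is weakly incompressible (has weak incompressibility) if $M\cap\overline{f(A\setminus M)}\ne\emptyset$ whenever $M$ is a nonempty,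 closed, proper subset of $A$. $f$ has limit shadowing on $\Lambda\subseteq X$ if for every asymptotic pseudo-orbit $\{x_n\}_{n\in\mathbb{N}}\subseteq\Lambda$ there is $y\in X$ with $\lim_{n\to\infty}d(f^n(y),x_n)=0$. $f$ has shadowing if for every $\varepsilon>0$ there is $\delta>0$ such that for every infinite $\delta$-pseudo-orbit $\{x_n\}_{n\in\mathbb{N}}$ in $X$ there is $y\in X$ with $d(f^n(y),x_n)<\varepsilon$ for all $n\in\mathbb{N}$. $f$ has h-shadowing on $\Lambda\subseteq X$ if for every $\varepsilon>0$ there is $\delta>0$ such that for every finite $\delta$-pseudo-orbit $\{x_0,x_1,\dots,x_m\}\subseteq\Lambda$ there is $y\in X$ with $d(f^i(y),x_i)<\varepsilon$ for every $i<m$ and $f^m(y)=x_m$. A surjective map $f$ is $c$-expansive (with expansive constant $b'>0$) if for any $x,y\in X$ and any full orbits $\{x_n\}_{n\in\mathbb{Z}}$ and $\{y_n\}_{n\in\mathbb{Z}}$ through $x$ and $y$ respectively (i.e. $x_0=x$, $y_0=y$, $f(x_n)=x_{n+1}$, $f(y_n)=y_{n+1}$ for all $n\in\mathbb{Z}$), the condition $d(x_n,y_n)<b'$ for every $n\in\mathbb{Z}$ implies $x=y$. $f$ is topologically hyperbolic if it is both $c$-expansive (in particular surjective) and has shadowing. For closed $\Lambda\subseteq X$, $f$ is expanding on $\Lambda$ if there are $\delta>0$ and $\mu>1$ such that $d(f(x),f(y))\ge\mu\, d(x,y)$ whenever $x,y\in\Lambda$ and $d(x,y)<\delta$. For $S\subseteq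 X$, $f$ is open on $S$ if for every $x\in S$ and every neighbourhood $U$ of $x$ in $X$, $f(x)\in\operatorname{int}(f(U))$. $f$ is open on a neighbourhood of $\Lambda$ if there is an open set $W\supseteq\Lambda$ such that $f$ is open on $W$.
   Formalization: (a)⇒(b) is claimed only when A is not a single non-fixed point (singletons are vacuously weakly incompressible), and in (3) the expanding inequality is required for x∈Λ and all y∈X with d(x,y)<δ, not only y∈Λ; as written the claim fails in both cases. *)

theory Defs
  imports "HOL-Analysis.Analysis"
begin

text \<open>
  The compact metric space \<open>X\<close> is a whole type of class \<open>metric_space\<close>; compactness is the
  assumption \<open>compact UNIV\<close> of the theorem. Thus \<open>closure\<close>, \<open>interior\<close>, \<open>open\<close> and \<open>closed\<close>
  are those of \<open>X\<close>. Iterates are written \<open>f ^^ n\<close>.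
\<close>

definition omega_limit :: "('a::metric_space \<Rightarrow> 'a) \<Rightarrow> 'a \<Rightarrow> 'a set" where
  "omega_limit f x = (\<Inter>k. closure {(f ^^ n) x | n. n \<ge> k})"

text \<open>A finite pseudo-orbit \<open>x\<^sub>0, \<dots>, x\<^sub>m\<close> is a function on \<open>nat\<close> of which only the values at
  arguments \<open>\<le> m\<close> are used.\<close>

definition finite_pseudo_orbit ::
    "('a::metric_space \<Rightarrow> 'a) \<Rightarrow> real \<Rightarrow> nat \<Rightarrow> (nat \<Rightarrow> 'a) \<Rightarrow> bool" where
  "finite_pseudo_orbit f \<epsilon> m x \<longleftrightarrow> (\<forall>i<m. dist (f (x i)) (x (Suc i)) < \<epsilon>)"

definition pseudo_orbit :: "('a::metric_space \<Rightarrow> 'a) \<Rightarrow> real \<Rightarrow> (nat \<Rightarrow> 'a) \<Rightarrow> bool" where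
  "pseudo_orbit f \<epsilon> x \<longleftrightarrow> (\<forall>n. dist (f (x n)) (x (Suc n)) < \<epsilon>)"

definition asymptotic_pseudo_orbit :: "('a::metric_space \<Rightarrow> 'a) \<Rightarrow> (nat \<Rightarrow> 'a) \<Rightarrow> bool" where
  "asymptotic_pseudo_orbit f x \<longleftrightarrow> (\<lambda>n. dist (f (x n)) (x (Suc n))) \<longlonglongrightarrow> 0"

definition internally_chain_transitive :: "('a::metric_space \<Rightarrow> 'a) \<Rightarrow> 'a set \<Rightarrow> bool" where
  "internally_chain_transitive f A \<longleftrightarrow>
     (\<forall>a\<in>A. \<forall>b\<in>A. \<forall>\<epsilon>>0. \<exists>m\<ge>1. \<exists>x. finite_pseudo_orbit f \<epsilon> m x \<and>
        x 0 = a \<and> x m = b \<and> (\<forall>i\<le>m. x i \<in> A))"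

definition weakly_incompressible :: "('a::metric_space \<Rightarrow> 'a) \<Rightarrow> 'a set \<Rightarrow> bool" where
  "weakly_incompressible f A \<longleftrightarrow>
     (\<forall>M. M \<noteq> {} \<and> closed M \<and> M \<subset> A \<longrightarrow> M \<inter> closure (f ` (A - M)) \<noteq> {})"

text \<open>Every singleton is vacuously weakly incompressible, whereas only a fixed point forms an
  internally chain transitive singleton.\<close>

lemma weakly_incompressible_singleton: "weakly_incompressible f {p}"
  by (auto simp: weakly_incompressible_def psubset_eq subset_singleton_iff)

lemma internally_chain_transitive_singletonD:
  assumes "internally_chain_transitive f {p}"
  shows "f p = p"
proof (rule ccontr)
  assume "f p \<noteq> p"
  then have "dist (f p) p > 0" by simp
  with assms obtain m x where m: "m \<ge> (1::nat)"
    and x: "finite_pseudo_orbit f (dist (f p) p) m x" "\<forall>i\<le>m. x i \<in> {p}"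
    unfolding internally_chain_transitive_def by blast
  from m have "dist (f (x 0)) (x (Suc 0)) < dist (f p) p"
    using x(1) unfolding finite_pseudo_orbit_def by auto
  moreover have "x 0 = p" "x (Suc 0) = p" using x(2) m by auto
  ultimately show False by simp
qed

definition limit_shadowing_on :: "('a::metric_space \<Rightarrow> 'a) \<Rightarrow> 'a set \<Rightarrow> bool" where
  "limit_shadowing_on f S \<longleftrightarrow>
     (\<forall>x. asymptotic_pseudo_orbit f x \<and> range x \<subseteq> S \<longrightarrow>
        (\<exists>y. (\<lambda>n. dist ((f ^^ n) y) (x n)) \<longlonglongrightarrow> 0))"

definition shadowing :: "('a::metric_space \<Rightarrow> 'a) \<Rightarrow> bool" where
  "shadowing f \<longleftrightarrow>
     (\<forall>\<epsilon>>0. \<exists>\<delta>>0. \<forall>x. pseudo_orbit f \<delta> x \<longrightarrow> (\<exists>y. \<forall>n. dist ((f ^^ n) y) (x n) < \<epsilon>))"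

definition h_shadowing_on :: "('a::metric_space \<Rightarrow> 'a) \<Rightarrow> 'a set \<Rightarrow> bool" where
  "h_shadowing_on f S \<longleftrightarrow>
     (\<forall>\<epsilon>>0. \<exists>\<delta>>0. \<forall>m x. finite_pseudo_orbit f \<delta> m x \<and> (\<forall>i\<le>m. x i \<in> S) \<longrightarrow>
        (\<exists>y. (\<forall>i<m. dist ((f ^^ i) y) (x i) < \<epsilon>) \<and> (f ^^ m) y = x m))"

definition full_orbit :: "('a \<Rightarrow> 'a) \<Rightarrow> 'a \<Rightarrow> (int \<Rightarrow> 'a) \<Rightarrow> bool" where
  "full_orbit f x u \<longleftrightarrow> u 0 = x \<and> (\<forall>n. f (u n) = u (n + 1))"

definition c_expansive :: "('a::metric_space \<Rightarrow> 'a) \<Rightarrow> bool" where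
  "c_expansive f \<longleftrightarrow> surj f \<and>
     (\<exists>b>0. \<forall>x y u v. full_orbit f x u \<and> full_orbit f y v \<and> (\<forall>n. dist (u n) (v n) < b)
        \<longrightarrow> x = y)"

definition topologically_hyperbolic :: "('a::metric_space \<Rightarrow> 'a) \<Rightarrow> bool" where
  "topologically_hyperbolic f \<longleftrightarrow> c_expansive f \<and> shadowing f"

text \<open>Only the first point is restricted to \<open>S\<close>; the second ranges over all of \<open>X\<close>. With both
  points in \<open>S\<close> the condition says nothing about the preimages near \<open>S\<close> that openness
  provides, and expanding plus open on \<open>S\<close> would not make internally chain transitive closed
  subsets of \<open>S\<close> into \<open>\<omega>\<close>-limit sets. For \<open>S = X\<close> the two readings agree.\<close>

definition expanding_on :: "('a::metric_space \<Rightarrow> 'a) \<Rightarrow> 'a set \<Rightarrow> bool" where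
  "expanding_on f S \<longleftrightarrow>
     (\<exists>\<delta>>0. \<exists>\<mu>>1. \<forall>x\<in>S. \<forall>y. dist x y < \<delta> \<longrightarrow> dist (f x) (f y) \<ge> \<mu> * dist x y)"

text \<open>\<open>U\<close> is a neighbourhood of \<open>x\<close> in \<open>X\<close> iff \<open>x \<in> interior U\<close>. This is openness of \<open>f\<close> at
  the points of \<open>S\<close>, not of the restriction of \<open>f\<close> to \<open>S\<close>.\<close>

definition open_map_at_points :: "('a::metric_space \<Rightarrow> 'a) \<Rightarrow> 'a set \<Rightarrow> bool" where
  "open_map_at_points f S \<longleftrightarrow>
     (\<forall>x\<in>S. \<forall>U. x \<in> interior U \<longrightarrow> f x \<in> interior (f ` U))"

definition open_map_near :: "('a::metric_space \<Rightarrow> 'a) \<Rightarrow> 'a set \<Rightarrow> bool" where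
  "open_map_near f S \<longleftrightarrow> (\<exists>W. open W \<and> S \<subseteq> W \<and> open_map_at_points f W)"

end

theory Submission
  imports Defs
begin

text \<open>
  Weak incompressibility and chain transitivity are two views of one condition. The points of
  \<open>A\<close> reachable from \<open>a\<close> by \<open>\<epsilon>\<close>-chains form a relatively open set whose image keeps a distance of
  \<open>\<epsilon>\<close> from its complement in \<open>A\<close>; so weak incompressibility forces the complement to be empty.
  Conversely, a set \<open>M\<close> that violates weak incompressibility is at positive distance from
  \<open>f ` (A - M)\<close>, and no sufficiently fine chain can enter it. A limit set is chain transitive
  since an orbit that is eventually close to it can be projected onto it.

  The substance is the realisation of a chain transitive closed set \<open>A\<close> as a limit set. List a
  sequence \<open>z\<close> in \<open>A\<close> that visits every neighbourhood of every point infinitely often, join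
  \<open>z k\<close> to \<open>z (Suc k)\<close> by chains in \<open>A\<close> of better and better accuracy, and concatenate them. A
  point whose orbit is asymptotic to the resulting sequence has limit set \<open>A\<close>
  (\<open>omega_limit_eq_if_tracked\<close>). There are two ways to find such a point.

  Limit shadowing provides it at once. Topological hyperbolicity implies limit shadowing: an
  orbit that stays within half an expansivity constant of an asymptotic pseudo-orbit must
  converge to it, because otherwise a limit of shifted copies would be a pair of distinct full
  orbits that remain too close.

  In the two cases with openness the common tool is a strengthening of h-shadowing,
  \<open>ball_h_shadowing_on\<close>: not only the end of a fine chain but every point of a ball around it is
  reached by an orbit that follows the chain. The radius of the ball depends on the chain.
  Chain transitivity turns this into a recursion: choose the chain from \<open>z k\<close> to
  \<open>z (Suc k)\<close> first, obtain its radius, and only then choose the next chain, so fine that orbits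
  following it start inside this ball. Pulling back through finitely many chains and
  passing to the limit by compactness gives an orbit that follows all of them
  (\<open>tracks_chain_sequence\<close>).
\<close>

section \<open>Compactness\<close>

lemma nested_closed_sets_meet:
  fixes F :: "nat \<Rightarrow> 'a::metric_space set"
  assumes "compact (UNIV :: 'a set)" and "\<And>n. closed (F n)" and "\<And>n. F n \<noteq> {}"
    and "\<And>n. F (Suc n) \<subseteq> F n"
  obtains p where "\<And>n. p \<in> F n"
proof -
  have mono: "F n \<subseteq> F m" if "m \<le> n" for m n
    using lift_Suc_antimono_le[of F, OF assms(4) that] .
  have "\<exists>s. \<forall>n. s n \<in> F n"
    using assms(3) by (intro choice) auto
  then obtain s where s: "\<And>n. s n \<in> F n" by blast
  obtain p r where r: "strict_mono r" and lim: "(s \<circ> r) \<longlonglongrightarrow> p"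
    using compact_imp_seq_compact[OF assms(1)] unfolding seq_compact_def by (metis UNIV_I)
  have "p \<in> F n" for n
  proof (rule Lim_in_closed_set[OF assms(2) _ _ lim])
    show "\<forall>\<^sub>F k in sequentially. (s \<circ> r) k \<in> F n"
      using eventually_ge_at_top[of n]
      by eventually_elim (metis comp_apply mono order_trans s seq_suble[OF r] subset_iff)
  qed auto
  then show thesis using that by blast
qed

text \<open>Enumerating a countable dense subset through the first component of the pairing function
  makes each of its points occur infinitely often.\<close>

lemma compact_recurrent_dense_sequence:
  fixes A :: "'a::metric_space set"
  assumes "compact A" and "A \<noteq> {}"
  shows "\<exists>z :: nat \<Rightarrow> 'a. range z \<subseteq> A \<and>
    (\<forall>a\<in>A. \<forall>\<epsilon>>0. \<forall>N. \<exists>n\<ge>N. dist (z n) a < \<epsilon>)"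
proof -
  have "\<exists>D. finite D \<and> D \<subseteq> A \<and> A \<subseteq> (\<Union>x\<in>D. ball x (1 / Suc n))" for n
    using compactE_image[OF assms(1), of A "\<lambda>x. ball x (1 / Suc n)"] by fastforce
  then obtain D where D: "\<And>n::nat. finite (D n)" "\<And>n. D n \<subseteq> A"
      "\<And>n. A \<subseteq> (\<Union>x\<in>D n. ball x (1 / Suc n))"
    by metis
  define E where "E = (\<Union>n. D n)"
  have E: "countable E" "E \<subseteq> A" using D by (auto simp: E_def countable_finite)
  have "E \<noteq> {}" using assms(2) D(3)[of 0] by (auto simp: E_def)
  define z where "z n = from_nat_into E (fst (prod_decode n))" for n
  have "range z \<subseteq> A"
    using from_nat_into[OF \<open>E \<noteq> {}\<close>] E(2) by (auto simp: z_def)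
  moreover have "\<exists>n\<ge>N. dist (z n) a < \<epsilon>" if "a \<in> A" "\<epsilon> > 0" for a \<epsilon> and N :: nat
  proof -
    obtain k :: nat where k: "1 / Suc k < \<epsilon>"
      using \<open>\<epsilon> > 0\<close> nat_approx_posE by blast
    obtain x where x: "x \<in> D k" "dist x a < 1 / Suc k"
      using D(3)[of k] \<open>a \<in> A\<close> by auto
    then obtain j where j: "from_nat_into E j = x"
      using from_nat_into_surj[OF E(1)] by (auto simp: E_def)
    have "z (prod_encode (j, N)) = x" by (simp add: z_def j)
    moreover have "N \<le> prod_encode (j, N)" by (rule le_prod_encode_2)
    ultimately show ?thesis using x k by (meson order_less_trans)
  qed
  ultimately show ?thesis by (intro exI[of _ z] conjI ballI allI impI)
qed

lemma compact_uniformly_continuousE: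
  fixes f :: "'a::metric_space \<Rightarrow> 'a"
  assumes "compact (UNIV :: 'a set)" "continuous_on UNIV f" "\<epsilon> > 0"
  obtains \<delta> where "\<delta> > 0" "\<And>x y. dist x y < \<delta> \<Longrightarrow> dist (f x) (f y) < \<epsilon>"
  using compact_uniformly_continuous[OF assms(2,1)] assms(3)
  unfolding uniformly_continuous_on_def by (metis UNIV_I dist_commute)

lemma continuous_on_iterate:
  fixes f :: "'a::topological_space \<Rightarrow> 'a"
  assumes "continuous_on UNIV f"
  shows "continuous_on UNIV (f ^^ n)"
proof (induction n)
  case (Suc n)
  then show ?case
    using continuous_on_compose[OF Suc continuous_on_subset[OF assms subset_UNIV]] by simp
qed (simp add: id_def)

section \<open>Weak incompressibility and chain transitivity\<close>

text \<open>If \<open>f a\<close> were outside \<open>A\<close>, then removing from \<open>A\<close> a ball around \<open>a\<close> so small that its image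
  stays near \<open>f a\<close> would leave a set \<open>M\<close> contradicting weak incompressibility.\<close>

lemma weakly_incompressible_forward_invariant:
  fixes f :: "'a::metric_space \<Rightarrow> 'a"
  assumes "continuous_on UNIV f" "closed A" "weakly_incompressible f A" "a \<in> A" "A \<noteq> {a}"
  shows "f a \<in> A"
proof (rule ccontr)
  assume "f a \<notin> A"
  then obtain r where r: "r > 0" "ball (f a) r \<subseteq> - A"
    using assms(2) by (meson ComplI open_Compl open_contains_ball)
  obtain d where d: "d > 0" "\<And>x. dist x a < d \<Longrightarrow> dist (f x) (f a) < r / 2"
    using assms(1) r(1) unfolding continuous_on_iff by (metis UNIV_I half_gt_zero)
  obtain b where b: "b \<in> A" "b \<noteq> a" using assms(4,5) by blast
  \<comment> \<open>The radius is at most \<open>dist a b\<close> so that \<open>b\<close> keeps \<open>M\<close> nonempty.\<close>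
  define M where "M = A - ball a (min d (dist a b))"
  have "a \<notin> M" using b d(1) by (simp add: M_def)
  have "M \<noteq> {} \<and> closed M \<and> M \<subset> A"
  proof (intro conjI)
    show "closed M" unfolding M_def using assms(2) by (intro closed_Diff) auto
    show "M \<noteq> {}" using b by (auto simp: M_def)
    show "M \<subset> A" using assms(4) \<open>a \<notin> M\<close> unfolding M_def by blast
  qed
  then obtain p where p: "p \<in> M" "p \<in> closure (f ` (A - M))"
    using assms(3) unfolding weakly_incompressible_def by blast
  have "f ` (A - M) \<subseteq> cball (f a) (r / 2)"
    using d(2) by (fastforce simp: M_def dist_commute)
  then have "p \<in> cball (f a) (r / 2)"
    using p(2) closure_minimal[OF _ closed_cball] by blast
  then have "p \<in> ball (f a) r" using r(1) by simp
  then show False using r(2) p(1) by (auto simp: M_def)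
qed

text \<open>The set of points not reachable from \<open>a\<close> by \<open>\<epsilon>\<close>-chains is closed, and it cannot meet the
  closure of the image of the reachable points, since a chain extends to every point of \<open>A\<close>
  within \<open>\<epsilon>\<close> of the image of its end. It is a proper subset of \<open>A\<close> because \<open>f a\<close> is a point of \<open>A\<close>
  and is reachable; this is where forward invariance is used. A singleton has no nonempty proper subsets, so there
  invariance is a hypothesis.\<close>

lemma weakly_incompressible_imp_internally_chain_transitive:
  fixes f :: "'a::metric_space \<Rightarrow> 'a"
  assumes "continuous_on UNIV f" "closed A" "weakly_incompressible f A"
    and "\<And>p. A = {p} \<Longrightarrow> f p = p"
  shows "internally_chain_transitive f A"
  unfolding internally_chain_transitive_def
proof (intro ballI allI impI)
  fix a b and \<epsilon> :: real
  assume a: "a \<in> A" and b: "b \<in> A" and \<epsilon>: "\<epsilon> > 0"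
  have inv: "f x \<in> A" if "x \<in> A" for x
    using weakly_incompressible_forward_invariant[OF assms(1-3) that] assms(4) that by blast
  define reach where "reach y \<longleftrightarrow> (\<exists>m\<ge>1. \<exists>x. finite_pseudo_orbit f \<epsilon> m x \<and>
        x 0 = a \<and> x m = y \<and> (\<forall>i\<le>m. x i \<in> A))" for y
  have step: "reach q" if "reach p" "q \<in> A" "dist (f p) q < \<epsilon>" for p q
  proof -
    obtain m x where m: "m \<ge> 1" "finite_pseudo_orbit f \<epsilon> m x" "x 0 = a" "x m = p"
        "\<forall>i\<le>m. x i \<in> A"
      using \<open>reach p\<close> unfolding reach_def by blast
    have "finite_pseudo_orbit f \<epsilon> (Suc m) (x(Suc m := q))"
      using m that(3) by (auto simp: finite_pseudo_orbit_def less_Suc_eq)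
    moreover have "\<forall>i\<le>Suc m. (x(Suc m := q)) i \<in> A"
      using m(5) that(2) by (auto simp: le_Suc_eq)
    ultimately show ?thesis
      using m unfolding reach_def by (intro exI[of _ "Suc m"] conjI exI[of _ "x(Suc m := q)"]) auto
  qed
  have first: "reach q" if "q \<in> A" "dist (f a) q < \<epsilon>" for q
    unfolding reach_def using that a
    by (intro exI[of _ 1] conjI exI[of _ "\<lambda>i. if i = 0 then a else q"])
       (auto simp: finite_pseudo_orbit_def)
  define M where "M = A - {y. reach y}"
  have "M = A - (\<Union>p\<in>insert a (A \<inter> {y. reach y}). ball (f p) \<epsilon>)"
  proof -
    have "\<exists>p\<in>insert a (A \<inter> {y. reach y}). dist (f p) y < \<epsilon>" if y: "reach y" for y
    proof -
      obtain m x where m: "m \<ge> 1" "finite_pseudo_orbit f \<epsilon> m x" "x 0 = a" "x m = y"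
          "\<forall>i\<le>m. x i \<in> A"
        using y unfolding reach_def by blast
      then obtain k where k: "m = Suc k" by (cases m) auto
      have "dist (f (x k)) y < \<epsilon>" using m k by (auto simp: finite_pseudo_orbit_def)
      moreover have "x k = a \<or> x k \<in> A \<and> reach (x k)"
      proof (cases "k = 0")
        case False
        then have "reach (x k)"
          using m k unfolding reach_def finite_pseudo_orbit_def
          by (intro exI[of _ k] conjI exI[of _ x]) auto
        then show ?thesis using m(5) k by auto
      qed (use m in simp)
      ultimately show ?thesis by blast
    qed
    then have "reach y \<longleftrightarrow> (\<exists>p\<in>insert a (A \<inter> {y. reach y}). dist (f p) y < \<epsilon>)"
      if "y \<in> A" for y
      using first[OF that] step[OF _ that] by blast
    then show ?thesis by (auto simp: M_def)
  qed
  then have "closed M" using assms(2) by (auto intro!: closed_Diff open_UN)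
  moreover have "M \<subset> A"
    using first[OF inv[OF a]] inv[OF a] \<epsilon> by (auto simp: M_def)
  moreover have "M \<inter> closure (f ` (A - M)) = {}"
  proof (rule ccontr)
    assume "M \<inter> closure (f ` (A - M)) \<noteq> {}"
    then obtain y where y: "y \<in> M" "y \<in> closure (f ` (A - M))" by blast
    then obtain p where "p \<in> A - M" "dist (f p) y < \<epsilon>"
      using \<epsilon> unfolding closure_approachable by blast
    then show False using step[of p y] y(1) by (auto simp: M_def)
  qed
  ultimately have "M = {}"
    using assms(3) unfolding weakly_incompressible_def by blast
  then have "reach b" using b by (auto simp: M_def)
  then show "\<exists>m\<ge>1. \<exists>x. finite_pseudo_orbit f \<epsilon> m x \<and> x 0 = a \<and> x m = b \<and> (\<forall>i\<le>m. x i \<in> A)"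
    unfolding reach_def .
qed

text \<open>A chain from outside \<open>M\<close> into \<open>M\<close> has a step from \<open>A - M\<close> into \<open>M\<close>; when \<open>M\<close> is at distance \<open>d\<close>
  from \<open>f ` (A - M)\<close>, a \<open>d\<close>-chain has no such step.\<close>

lemma internally_chain_transitive_imp_weakly_incompressible:
  fixes f :: "'a::metric_space \<Rightarrow> 'a"
  assumes "compact A" "internally_chain_transitive f A"
  shows "weakly_incompressible f A"
  unfolding weakly_incompressible_def
proof (intro allI impI notI)
  fix M assume M: "M \<noteq> {} \<and> closed M \<and> M \<subset> A" and disj: "M \<inter> closure (f ` (A - M)) = {}"
  have "compact M"
    using M assms(1) by (metis compact_Int_closed inf.absorb_iff2 psubset_imp_subset)
  moreover have "open (- closure (f ` (A - M)))" by (intro open_Compl closed_closure)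
  moreover have "M \<subseteq> - closure (f ` (A - M))" using disj by blast
  ultimately obtain d where d: "d > 0" "(\<Union>p\<in>M. ball p d) \<subseteq> - closure (f ` (A - M))"
    by (rule compact_subset_open_imp_ball_epsilon_subset)
  obtain a b where "a \<in> A - M" "b \<in> M" using M by blast
  then have "a \<in> A" "b \<in> A" using M by auto
  then obtain m x where x: "finite_pseudo_orbit f d m x" "x 0 = a" "x m = b" "\<forall>i\<le>m. x i \<in> A"
    using assms(2) d(1) unfolding internally_chain_transitive_def by metis
  have "x i \<notin> M" if "i \<le> m" for i
    using that
  proof (induction i)
    case 0
    then show ?case using x(2) \<open>a \<in> A - M\<close> by simp
  next
    case (Suc i)
    then have "x i \<in> A - M" using x(4) by simp
    then have "f (x i) \<in> closure (f ` (A - M))" using closure_subset imageI subsetD by metis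
    moreover have "dist (f (x i)) (x (Suc i)) < d"
      using x(1) Suc.prems by (simp add: finite_pseudo_orbit_def)
    ultimately show ?case
    proof (intro notI)
      assume "x (Suc i) \<in> M"
      then have "f (x i) \<in> (\<Union>p\<in>M. ball p d)"
        using \<open>dist (f (x i)) (x (Suc i)) < d\<close> by (metis UN_I dist_commute mem_ball)
      then show False using d(2) \<open>f (x i) \<in> closure (f ` (A - M))\<close> by (metis ComplD subsetD)
    qed
  qed
  then show False using x(3) \<open>b \<in> M\<close> by blast
qed

section \<open>Limit sets are internally chain transitive\<close>

text \<open>The closed tails of the orbit decrease to the limit set, so by compactness some tail lies in
  its \<open>\<delta>\<close>-neighbourhood. The conclusion speaks of the image of the \<open>n\<close>-th point, the form in which
  the chain below is indexed.\<close>

lemma orbit_eventually_near_omega_limit: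
  fixes f :: "'a::metric_space \<Rightarrow> 'a"
  assumes "compact (UNIV :: 'a set)" "\<delta> > 0"
  obtains N where "\<And>n. n \<ge> N \<Longrightarrow> \<exists>p\<in>omega_limit f x. dist (f ((f ^^ n) x)) p < \<delta>"
proof -
  define F where "F k = closure {(f ^^ n) x | n. n \<ge> k} - (\<Union>p\<in>omega_limit f x. ball p \<delta>)" for k
  have "\<exists>k. F k = {}"
  proof (rule ccontr)
    assume "\<nexists>k. F k = {}"
    moreover have "F (Suc k) \<subseteq> F k" for k
      unfolding F_def by (intro Diff_mono closure_mono) auto
    moreover have "closed (F k)" for k
      unfolding F_def by (intro closed_Diff open_UN) auto
    ultimately obtain p where p: "\<And>k. p \<in> F k"
      using nested_closed_sets_meet[OF assms(1), of F] by metis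
    then have "p \<in> omega_limit f x" unfolding omega_limit_def F_def by blast
    then show False using p[of 0] \<open>\<delta> > 0\<close> by (auto simp: F_def)
  qed
  then obtain N where N: "F N = {}" ..
  have "\<exists>p\<in>omega_limit f x. dist (f ((f ^^ n) x)) p < \<delta>" if "n \<ge> N" for n
  proof -
    have "f ((f ^^ n) x) = (f ^^ Suc n) x" by simp
    then have "f ((f ^^ n) x) \<in> closure {(f ^^ n) x | n. n \<ge> N}"
      using that closure_subset[of "{(f ^^ n) x | n. n \<ge> N}"] le_SucI by blast
    then have "f ((f ^^ n) x) \<in> (\<Union>p\<in>omega_limit f x. ball p \<delta>)"
      using N unfolding F_def by blast
    then show ?thesis by (auto simp: dist_commute)
  qed
  then show thesis using that by blast
qed

lemma omega_limit_approached:
  assumes "p \<in> omega_limit f x" "\<epsilon> > 0"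
  obtains n where "n \<ge> N" "dist ((f ^^ n) x) p < \<epsilon>"
proof -
  have "p \<in> closure {(f ^^ n) x | n. n \<ge> N}" using assms(1) by (auto simp: omega_limit_def)
  then show thesis using that assms(2) by (auto simp: closure_approachable)
qed

text \<open>Between a visit near \<open>a\<close> and a later visit near \<open>b\<close>, replace every point of the orbit by a close
  point of the limit set. Uniform continuity makes the result a chain.\<close>

lemma omega_limit_internally_chain_transitive:
  fixes f :: "'a::metric_space \<Rightarrow> 'a"
  assumes "compact (UNIV :: 'a set)" "continuous_on UNIV f"
  shows "internally_chain_transitive f (omega_limit f x)"
  unfolding internally_chain_transitive_def
proof (intro ballI allI impI)
  let ?W = "omega_limit f x"
  fix a b and \<epsilon> :: real
  assume a: "a \<in> ?W" and b: "b \<in> ?W" and \<epsilon>: "\<epsilon> > 0"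
  obtain \<delta>' where \<delta>': "\<delta>' > 0" "\<And>x y. dist x y < \<delta>' \<Longrightarrow> dist (f x) (f y) < \<epsilon> / 2"
    using compact_uniformly_continuousE[OF assms, of "\<epsilon> / 2"] \<epsilon> by auto
  define \<delta> where "\<delta> = min \<delta>' (\<epsilon> / 2)"
  have \<delta>: "\<delta> > 0" using \<delta>' \<epsilon> by (simp add: \<delta>_def)
  obtain N where N: "\<And>n. n \<ge> N \<Longrightarrow> \<exists>p\<in>?W. dist (f ((f ^^ n) x)) p < \<delta>"
    using orbit_eventually_near_omega_limit[OF assms(1) \<delta>] by blast
  then obtain p where p: "\<And>n. n \<ge> N \<Longrightarrow> p n \<in> ?W \<and> dist (f ((f ^^ n) x)) (p n) < \<delta>"
    by metis
  obtain s where s: "s \<ge> N" "dist ((f ^^ s) x) a < \<delta>"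
    using omega_limit_approached[OF a \<delta>] by blast
  obtain t where t: "t \<ge> Suc s" "dist ((f ^^ t) x) b < \<delta>"
    using omega_limit_approached[OF b \<delta>] by blast
  define m where "m = t - s"
  define c where "c i = (if i = 0 then a else if i = m then b else p (s + i - 1))" for i
  have near: "dist ((f ^^ (s + i)) x) (c i) < \<delta> \<and> c i \<in> ?W" if "i \<le> m" for i
  proof -
    consider "i = 0" | "i = m" "i \<noteq> 0" | j where "i = Suc j" "i \<noteq> m" by (cases i) auto
    then show ?thesis
    proof cases
      case 2
      then have "s + i = t" using t(1) by (simp add: m_def)
      then show ?thesis using 2 t(2) b by (simp add: c_def)
    next
      case 3
      then show ?thesis using p[of "s + j"] s(1) by (simp add: c_def)
    qed (use s a in \<open>simp add: c_def\<close>)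
  qed
  have "dist (f (c i)) (c (Suc i)) < \<epsilon>" if "i < m" for i
  proof -
    have "dist (f ((f ^^ (s + i)) x)) (f (c i)) < \<epsilon> / 2"
      using near[of i] that \<delta>'(2) by (simp add: \<delta>_def)
    moreover have "dist (f ((f ^^ (s + i)) x)) (c (Suc i)) < \<epsilon> / 2"
      using near[of "Suc i"] that by (simp add: \<delta>_def)
    ultimately show ?thesis by (metis dist_triangle_half_r)
  qed
  then have "finite_pseudo_orbit f \<epsilon> m c" by (simp add: finite_pseudo_orbit_def)
  moreover have "m \<ge> 1" using t(1) by (simp add: m_def)
  moreover have "c 0 = a" "c m = b" using \<open>m \<ge> 1\<close> by (auto simp: c_def)
  ultimately show "\<exists>m\<ge>1. \<exists>x'. finite_pseudo_orbit f \<epsilon> m x' \<and> x' 0 = a \<and> x' m = b \<and>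
      (\<forall>i\<le>m. x' i \<in> ?W)"
    using near by blast
qed

section \<open>Concatenating chains\<close>

text \<open>Chain \<open>k\<close> occupies the positions from \<open>\<Sum>j<k. m j\<close> on. Its last point is the first one of the
  next chain, hence the equation also holds for \<open>i = m k\<close>, whereas in the decomposition of a
  position \<open>n\<close> the offset is \<open>< m k\<close>.\<close>

lemma concatenate_chains:
  fixes m :: "nat \<Rightarrow> nat" and c :: "nat \<Rightarrow> nat \<Rightarrow> 'a"
  assumes m: "\<And>k. m k \<ge> 1" and glue: "\<And>k. c k (m k) = c (Suc k) 0"
  obtains x where "\<And>k i. i \<le> m k \<Longrightarrow> x ((\<Sum>j<k. m j) + i) = c k i"
    and "\<And>n. \<exists>k i. i < m k \<and> n = (\<Sum>j<k. m j) + i"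
proof -
  define S where "S k = (\<Sum>j<k. m j)" for k
  define block where "block n = (LEAST k. n < S (Suc k))" for n
  define x where "x n = c (block n) (n - S (block n))" for n
  have S_Suc: "S (Suc k) = S k + m k" for k by (simp add: S_def)
  have S_mono: "S k \<le> S l" if "k \<le> l" for k l
    unfolding S_def using that by (intro sum_mono2) auto
  have block: "block (S k + i) = k" if "i < m k" for k i
    unfolding block_def
  proof (rule Least_equality)
    show "S k + i < S (Suc k)" using that by (simp add: S_Suc)
    show "k \<le> l" if "S k + i < S (Suc l)" for l
      using that S_mono[of "Suc l" k] by (meson le_add1 not_less_eq_eq order_less_le_trans not_le)
  qed
  have inside: "x (S k + i) = c k i" if "i < m k" for k i
    using block[OF that] by (simp add: x_def)
  have end_: "x (S k + m k) = c k (m k)" for k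
    using inside[of 0 "Suc k"] m[of "Suc k"] by (simp add: S_Suc glue)
  have "k \<le> S k" for k
  proof (induction k)
    case (Suc k)
    then show ?case using m[of k] by (simp add: S_Suc)
  qed simp
  have "\<exists>k i. i < m k \<and> n = S k + i" for n
  proof (induction n)
    case 0
    show ?case using m[of 0] by (intro exI[of _ 0]) (simp add: S_def)
  next
    case (Suc n)
    then obtain k i where ki: "i < m k" "n = S k + i" by blast
    show ?case
    proof (cases "Suc i < m k")
      case True
      then show ?thesis using ki by (intro exI[of _ k] exI[of _ "Suc i"]) simp
    next
      case False
      then have "Suc n = S (Suc k) + 0" using ki by (simp add: S_Suc)
      then show ?thesis using m[of "Suc k"] by (metis One_nat_def Suc_le_lessD)
    qed
  qed
  moreover have "x (S k + i) = c k i" if "i \<le> m k" for k i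
    using inside end_ that by (cases "i = m k") auto
  ultimately show thesis using that unfolding S_def by blast
qed

lemma concatenated_chain_late_block:
  fixes m :: "nat \<Rightarrow> nat"
  assumes "i < m k" and "(\<Sum>j<K. m j) \<le> (\<Sum>j<k. m j) + i"
  shows "K \<le> k"
proof (rule ccontr)
  assume "\<not> K \<le> k"
  then have "(\<Sum>j<Suc k. m j) \<le> (\<Sum>j<K. m j)" by (intro sum_mono2) auto
  then show False using assms by simp
qed

lemma omega_limit_eq_if_tracked:
  fixes f :: "'a::metric_space \<Rightarrow> 'a"
  assumes track: "(\<lambda>n. dist ((f ^^ n) y) (x n)) \<longlonglongrightarrow> 0"
    and "closed A" "range x \<subseteq> A"
    and dense: "\<And>a \<epsilon> N. a \<in> A \<Longrightarrow> \<epsilon> > 0 \<Longrightarrow> \<exists>n\<ge>N. dist (x n) a < \<epsilon>"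
  shows "omega_limit f y = A"
proof -
  have near: "\<exists>N. \<forall>n\<ge>N. dist ((f ^^ n) y) (x n) < \<epsilon>" if "\<epsilon> > 0" for \<epsilon>
    using track that by (auto simp: lim_sequentially)
  show ?thesis
  proof
    show "omega_limit f y \<subseteq> A"
    proof
      fix p assume p: "p \<in> omega_limit f y"
      have "\<exists>a\<in>A. dist a p < \<epsilon>" if \<epsilon>: "\<epsilon> > 0" for \<epsilon>
      proof -
        obtain N where N: "\<forall>n\<ge>N. dist ((f ^^ n) y) (x n) < \<epsilon> / 2"
          using near[OF half_gt_zero[OF \<epsilon>]] by blast
        obtain n where n: "n \<ge> N" "dist ((f ^^ n) y) p < \<epsilon> / 2"
          using omega_limit_approached[OF p half_gt_zero[OF \<epsilon>]] by blast
        then have "dist (x n) p < \<epsilon>" using N by (metis dist_triangle_half_r)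
        then show ?thesis using assms(3) by blast
      qed
      then show "p \<in> A" using \<open>closed A\<close> by (metis closed_approachable)
    qed
    show "A \<subseteq> omega_limit f y"
      unfolding omega_limit_def
    proof (intro subsetI INT_I)
      fix a k assume "a \<in> A"
      show "a \<in> closure {(f ^^ n) y | n. n \<ge> k}"
        unfolding closure_approachable
      proof (intro allI impI)
        fix \<epsilon> :: real assume \<epsilon>: "\<epsilon> > 0"
        then obtain N where N: "\<forall>n\<ge>N. dist ((f ^^ n) y) (x n) < \<epsilon> / 2"
          using near[OF half_gt_zero[OF \<epsilon>]] by blast
        obtain n where n: "n \<ge> max N k" "dist (x n) a < \<epsilon> / 2"
          using dense[OF \<open>a \<in> A\<close> half_gt_zero[OF \<epsilon>]] by blast
        then have "dist ((f ^^ n) y) a < \<epsilon>"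
          using N by (metis dist_triangle_half_l dist_commute max.boundedE)
        then show "\<exists>q\<in>{(f ^^ n) y | n. n \<ge> k}. dist q a < \<epsilon>" using n(1) by auto
      qed
    qed
  qed
qed

section \<open>Limit shadowing\<close>

lemma internally_chain_transitive_limit_shadowing_omega_limit:
  fixes f :: "'a::metric_space \<Rightarrow> 'a"
  assumes "compact A" "A \<noteq> {}" "internally_chain_transitive f A" "limit_shadowing_on f A"
  obtains y where "A = omega_limit f y"
proof -
  obtain z :: "nat \<Rightarrow> 'a" where z: "range z \<subseteq> A"
      "\<forall>a\<in>A. \<forall>\<epsilon>>0. \<forall>N. \<exists>n\<ge>N. dist (z n) a < \<epsilon>"
    using compact_recurrent_dense_sequence[OF assms(1,2)]
    by blast
  have "\<exists>m c. m \<ge> 1 \<and> finite_pseudo_orbit f (1 / Suc k) m c \<and> c 0 = z k \<and>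
      c m = z (Suc k) \<and> (\<forall>i\<le>m. c i \<in> A)" for k
  proof -
    have "z k \<in> A" "z (Suc k) \<in> A" "(0::real) < 1 / Suc k" using z(1) by auto
    then show ?thesis using assms(3) unfolding internally_chain_transitive_def by blast
  qed
  then obtain m c where mc: "\<And>k::nat. m k \<ge> (1::nat)"
      "\<And>k. finite_pseudo_orbit f (1 / Suc k) (m k) (c k)" "\<And>k. c k 0 = z k"
      "\<And>k. c k (m k) = z (Suc k)" "\<And>k. \<forall>i\<le>m k. c k i \<in> A"
    by metis
  obtain x where x: "\<And>k i. i \<le> m k \<Longrightarrow> x ((\<Sum>j<k. m j) + i) = c k i"
      "\<And>n. \<exists>k i. i < m k \<and> n = (\<Sum>j<k. m j) + i"
    using concatenate_chains[of m c] mc by metis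
  have range: "range x \<subseteq> A"
  proof (rule image_subsetI)
    fix n show "x n \<in> A" using x(2)[of n] x(1) mc(5) by (metis less_imp_le)
  qed
  have "asymptotic_pseudo_orbit f x"
    unfolding asymptotic_pseudo_orbit_def lim_sequentially
  proof (intro allI impI)
    fix \<epsilon> :: real assume "\<epsilon> > 0"
    then obtain K :: nat where K: "1 / Suc K < \<epsilon>" using nat_approx_posE by blast
    have "dist (f (x n)) (x (Suc n)) < \<epsilon>" if n: "n \<ge> (\<Sum>j<K. m j)" for n
    proof -
      obtain k i where ki: "i < m k" "n = (\<Sum>j<k. m j) + i" using x(2) by blast
      then have "K \<le> k" using concatenated_chain_late_block n by blast
      have "dist (f (x n)) (x (Suc n)) < 1 / Suc k"
        using x(1)[of i k] x(1)[of "Suc i" k] ki mc(2)[of k]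
        by (simp add: finite_pseudo_orbit_def)
      also have "\<dots> \<le> 1 / Suc K" using \<open>K \<le> k\<close> by (simp add: frac_le)
      finally show ?thesis using K by simp
    qed
    then show "\<exists>N. \<forall>n\<ge>N. dist (dist (f (x n)) (x (Suc n))) 0 < \<epsilon>" by auto
  qed
  then obtain y where y: "(\<lambda>n. dist ((f ^^ n) y) (x n)) \<longlonglongrightarrow> 0"
    using assms(4) range unfolding limit_shadowing_on_def by blast
  have "omega_limit f y = A"
  proof (rule omega_limit_eq_if_tracked[OF y compact_imp_closed[OF assms(1)] range])
    fix a N and \<epsilon> :: real assume "a \<in> A" "\<epsilon> > 0"
    then obtain k where k: "k \<ge> N" "dist (z k) a < \<epsilon>" using z(2) by blast
    have "x (\<Sum>j<k. m j) = z k" using x(1)[of 0 k] mc(3) by simp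
    moreover have "k \<le> (\<Sum>j<k. m j)" using sum_bounded_below[of "{..<k}" 1 m] mc(1) by simp
    ultimately show "\<exists>n\<ge>N. dist (x n) a < \<epsilon>" using k by (metis order_trans)
  qed
  then show thesis using that by blast
qed

text \<open>Two-sided sequences are functions on \<open>int\<close>. The \<open>s k\<close> need only satisfy the orbit equation
  asymptotically at each fixed index, so shifted one-sided orbits, continued to the left by junk,
  qualify as well as shifted asymptotic pseudo-orbits.\<close>

lemma limit_full_orbit:
  fixes f :: "'a::metric_space \<Rightarrow> 'a"
  assumes "continuous_on UNIV f"
    and "\<And>j. (\<lambda>k. s k j) \<longlonglongrightarrow> u j"
    and "\<And>j. (\<lambda>k. dist (f (s k j)) (s k (j + 1))) \<longlonglongrightarrow> 0"
  shows "full_orbit f (u 0) u"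
  unfolding full_orbit_def
proof (intro conjI allI)
  fix j :: int
  have "isCont f (u j)" using assms(1) by (simp add: continuous_on_eq_continuous_at)
  then have "(\<lambda>k. f (s k j)) \<longlonglongrightarrow> f (u j)"
    using assms(2) isCont_tendsto_compose by blast
  then have "(\<lambda>k. dist (f (s k j)) (s k (j + 1))) \<longlonglongrightarrow> dist (f (u j)) (u (j + 1))"
    using assms(2) by (intro tendsto_dist)
  then show "f (u j) = u (j + 1)"
    using LIMSEQ_unique[OF assms(3)] by force
qed simp

text \<open>A tail of an asymptotic pseudo-orbit is fine enough to be shadowed within half the expansive
  constant \<open>b\<close>, and surjectivity pulls the shadowing point back to time \<open>0\<close>. If the distance did
  not tend to \<open>0\<close>, it would be at least some \<open>\<eta>\<close> at times \<open>t M\<close> tending to infinity. Shifting these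
  times to \<open>0\<close> and taking a limit in the compact metrizable space of two-sided sequences of pairs
  gives two full orbits that are always within \<open>b / 2\<close> and differ at time \<open>0\<close>.\<close>

lemma topologically_hyperbolic_imp_limit_shadowing:
  fixes f :: "'a::metric_space \<Rightarrow> 'a"
  assumes cpt: "compact (UNIV :: 'a set)" and cont: "continuous_on UNIV f"
    and "topologically_hyperbolic f"
  shows "limit_shadowing_on f S"
  unfolding limit_shadowing_on_def
proof (intro allI impI)
  fix x assume "asymptotic_pseudo_orbit f x \<and> range x \<subseteq> S"
  then have apo: "(\<lambda>n. dist (f (x n)) (x (Suc n))) \<longlonglongrightarrow> 0"
    by (simp add: asymptotic_pseudo_orbit_def)
  obtain b where b: "b > 0" "\<And>x y u v. full_orbit f x u \<Longrightarrow> full_orbit f y v \<Longrightarrow>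
      \<forall>n. dist (u n) (v n) < b \<Longrightarrow> x = y" and surj: "surj f"
    using assms(3) unfolding topologically_hyperbolic_def c_expansive_def by metis
  obtain \<delta> where \<delta>: "\<delta> > 0" "\<And>x. pseudo_orbit f \<delta> x \<Longrightarrow> \<exists>y. \<forall>n. dist ((f ^^ n) y) (x n) < b / 2"
    using assms(3) b(1) unfolding topologically_hyperbolic_def shadowing_def
    by (metis half_gt_zero)
  obtain N where "\<forall>n\<ge>N. dist (f (x n)) (x (Suc n)) < \<delta>"
    using apo \<delta>(1) by (auto simp: lim_sequentially)
  then have "pseudo_orbit f \<delta> (\<lambda>n. x (N + n))" by (simp add: pseudo_orbit_def)
  then obtain y' where y': "\<And>n. dist ((f ^^ n) y') (x (N + n)) < b / 2" using \<delta>(2) by blast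
  obtain y where y: "(f ^^ N) y = y'" using surj surj_fn[of f N] by (metis surjD)
  have close: "dist ((f ^^ n) y) (x n) < b / 2" if "n \<ge> N" for n
  proof -
    have "(f ^^ n) y = (f ^^ (n - N)) y'"
      using y that funpow_add[of "n - N" N f] by simp
    then show ?thesis using y'[of "n - N"] that by simp
  qed
  have "(\<lambda>n. dist ((f ^^ n) y) (x n)) \<longlonglongrightarrow> 0"
  proof (rule ccontr)
    assume "\<not> ?thesis"
    then obtain \<eta> where \<eta>: "\<eta> > 0" "\<And>M. \<exists>n\<ge>M. dist ((f ^^ n) y) (x n) \<ge> \<eta>"
      by (auto simp: lim_sequentially not_less)
    then obtain t where t: "\<And>M. t M \<ge> M" "\<And>M. dist ((f ^^ t M) y) (x (t M)) \<ge> \<eta>" by metis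
    \<comment> \<open>For \<open>j < - t k\<close> truncation by \<open>nat\<close> gives a constant; at a fixed \<open>j\<close> this affects only
        finitely many \<open>k\<close>.\<close>
    define p where "p k j = ((f ^^ nat (int (t k) + j)) y, x (nat (int (t k) + j)))" for k j
    have "compact (PiE UNIV (\<lambda>_::int. UNIV :: ('a \<times> 'a) set))"
      using compactin_PiE[of "\<lambda>_::int. euclidean :: ('a \<times> 'a) topology" UNIV "\<lambda>_. UNIV"]
        compact_Times[OF cpt cpt]
      by (simp add: euclidean_product_topology)
    then have "seq_compact (UNIV :: (int \<Rightarrow> 'a \<times> 'a) set)"
      using compact_imp_seq_compact by (simp add: PiE_UNIV_domain)
    then obtain q r where r: "strict_mono r" and q: "(p \<circ> r) \<longlonglongrightarrow> q"
      unfolding seq_compact_def by (metis UNIV_I)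
    have lim: "(\<lambda>k. p (r k) j) \<longlonglongrightarrow> q j" for j
      using continuous_on_tendsto_compose[OF continuous_on_product_coordinates[of j] q]
      by (simp add: comp_def)
    have late: "\<forall>\<^sub>F k in sequentially. int (t (r k)) + j \<ge> int M" for j M
      using eventually_ge_at_top[of "nat (int M - j)"]
    proof eventually_elim
      case (elim k)
      then show ?case using t(1)[of "r k"] seq_suble[OF r, of k] by linarith
    qed
    have orbit: "full_orbit f (fst (q 0)) (\<lambda>j. fst (q j))"
    proof (rule limit_full_orbit[OF cont tendsto_fst[OF lim]])
      fix j
      have "\<forall>\<^sub>F k in sequentially. dist (f (fst (p (r k) j))) (fst (p (r k) (j + 1))) = 0"
        using late[of 0 j]
      proof eventually_elim
        case (elim k)
        then have "nat (int (t (r k)) + (j + 1)) = Suc (nat (int (t (r k)) + j))" by simp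
        then show ?case by (simp add: p_def)
      qed
      then show "(\<lambda>k. dist (f (fst (p (r k) j))) (fst (p (r k) (j + 1)))) \<longlonglongrightarrow> 0"
        by (rule tendsto_eventually)
    qed
    have porbit: "full_orbit f (snd (q 0)) (\<lambda>j. snd (q j))"
    proof (rule limit_full_orbit[OF cont tendsto_snd[OF lim]])
      fix j
      show "(\<lambda>k. dist (f (snd (p (r k) j))) (snd (p (r k) (j + 1)))) \<longlonglongrightarrow> 0"
        unfolding tendsto_iff
      proof (intro allI impI)
        fix \<epsilon> :: real assume "\<epsilon> > 0"
        then obtain M where M: "\<forall>n\<ge>M. dist (f (x n)) (x (Suc n)) < \<epsilon>"
          using apo by (auto simp: lim_sequentially)
        show "\<forall>\<^sub>F k in sequentially.
            dist (dist (f (snd (p (r k) j))) (snd (p (r k) (j + 1)))) 0 < \<epsilon>"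
          using late[of M j]
        proof eventually_elim
          case (elim k)
          then have "nat (int (t (r k)) + (j + 1)) = Suc (nat (int (t (r k)) + j))"
            and "nat (int (t (r k)) + j) \<ge> M" by simp_all
          then show ?case using M by (simp add: p_def)
        qed
      qed
    qed
    have "dist (fst (q j)) (snd (q j)) < b" for j
    proof -
      have "dist (fst (q j)) (snd (q j)) \<le> b / 2"
      proof (rule tendsto_upperbound[OF tendsto_dist[OF tendsto_fst[OF lim] tendsto_snd[OF lim]]])
        show "\<forall>\<^sub>F k in sequentially. dist (fst (p (r k) j)) (snd (p (r k) j)) \<le> b / 2"
          using late[of N j]
        proof eventually_elim
          case (elim k)
          then have "nat (int (t (r k)) + j) \<ge> N" by simp
          then show ?case using close by (simp add: p_def less_imp_le)
        qed
      qed simp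
      then show ?thesis using b(1) by simp
    qed
    then have "fst (q 0) = snd (q 0)" using b(2)[OF orbit porbit] by blast
    moreover have "\<eta> \<le> dist (fst (q 0)) (snd (q 0))"
    proof (rule tendsto_lowerbound[OF tendsto_dist[OF tendsto_fst[OF lim] tendsto_snd[OF lim]]])
      show "\<forall>\<^sub>F k in sequentially. \<eta> \<le> dist (fst (p (r k) 0)) (snd (p (r k) 0))"
        using t(2) by (simp add: p_def)
    qed simp
    ultimately show False using \<eta>(1) by simp
  qed
  then show "\<exists>y. (\<lambda>n. dist ((f ^^ n) y) (x n)) \<longlonglongrightarrow> 0" by blast
qed

section \<open>Shadowing a chain with every endpoint in a ball\<close>

definition tracks_into_ball ::
    "('a::metric_space \<Rightarrow> 'a) \<Rightarrow> nat \<Rightarrow> (nat \<Rightarrow> 'a) \<Rightarrow> real \<Rightarrow> real \<Rightarrow> bool" where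
  "tracks_into_ball f m c \<epsilon> \<eta> \<longleftrightarrow>
     (\<forall>v. dist v (c m) < \<eta> \<longrightarrow> (\<exists>w. (f ^^ m) w = v \<and> (\<forall>i<m. dist ((f ^^ i) w) (c i) < \<epsilon>)))"

text \<open>The radius \<open>\<eta>\<close> may depend on the chain, since openness of the iterates \<open>f ^^ m\<close> comes with no
  bound uniform in \<open>m\<close>.\<close>

definition ball_h_shadowing_on :: "('a::metric_space \<Rightarrow> 'a) \<Rightarrow> 'a set \<Rightarrow> bool" where
  "ball_h_shadowing_on f S \<longleftrightarrow>
     (\<forall>\<epsilon>>0. \<exists>\<delta>>0. \<forall>m c. finite_pseudo_orbit f \<delta> m c \<and> (\<forall>i\<le>m. c i \<in> S) \<longrightarrow>
        (\<exists>\<eta>>0. tracks_into_ball f m c \<epsilon> \<eta>))"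

text \<open>If \<open>f\<close> maps \<open>ball p (\<eta> / 2)\<close> onto a neighbourhood of \<open>f p\<close> of radius \<open>2 * \<rho> p\<close>, then \<open>\<rho> p\<close> serves
  all points near \<open>p\<close>; a finite subcover makes the radius uniform.\<close>

lemma open_map_at_points_uniform:
  fixes f :: "'a::metric_space \<Rightarrow> 'a"
  assumes "compact S" "continuous_on UNIV f" "open_map_at_points f S" "\<eta> > 0"
  obtains \<rho> where "\<rho> > 0" "\<And>x. x \<in> S \<Longrightarrow> ball (f x) \<rho> \<subseteq> f ` ball x \<eta>"
proof -
  have "\<exists>\<rho>>0. ball (f x) (2 * \<rho>) \<subseteq> f ` ball x (\<eta> / 2)" if "x \<in> S" for x
  proof -
    have "f x \<in> interior (f ` ball x (\<eta> / 2))"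
      using assms(3,4) that unfolding open_map_at_points_def by simp
    then obtain e where "e > 0" "ball (f x) e \<subseteq> f ` ball x (\<eta> / 2)"
      by (auto simp: mem_interior)
    then show ?thesis by (intro exI[of _ "e / 2"]) auto
  qed
  then obtain \<rho> where \<rho>: "\<And>x. x \<in> S \<Longrightarrow> \<rho> x > 0 \<and> ball (f x) (2 * \<rho> x) \<subseteq> f ` ball x (\<eta> / 2)"
    by metis
  define U where "U x = ball x (\<eta> / 2) \<inter> f -` ball (f x) (\<rho> x)" for x
  have "open (U x)" for x
    unfolding U_def using assms(2) by (intro open_Int open_ball open_vimage)
  moreover have "S \<subseteq> (\<Union>x\<in>S. U x)" using \<rho> assms(4) by (auto simp: U_def)
  ultimately obtain D where D: "D \<subseteq> S" "finite D" "S \<subseteq> (\<Union>x\<in>D. U x)"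
    by (rule compactE_image[OF assms(1)])
  define r where "r = Min (insert 1 (\<rho> ` D))"
  have "r > 0" using D \<rho> by (auto simp: r_def)
  moreover have "ball (f x) r \<subseteq> f ` ball x \<eta>" if "x \<in> S" for x
  proof -
    obtain p where p: "p \<in> D" "dist p x < \<eta> / 2" "dist (f p) (f x) < \<rho> p"
    proof -
      obtain p where "p \<in> D" "x \<in> U p" using D(3) \<open>x \<in> S\<close> by blast
      then show thesis using that[of p] by (simp add: U_def)
    qed
    have "r \<le> \<rho> p" using D(2) p(1) by (simp add: r_def)
    have "ball (f x) r \<subseteq> ball (f p) (2 * \<rho> p)"
    proof
      fix v assume "v \<in> ball (f x) r"
      then show "v \<in> ball (f p) (2 * \<rho> p)"
        using p(3) \<open>r \<le> \<rho> p\<close> dist_triangle[of "f p" v "f x"] by simp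
    qed
    also have "\<dots> \<subseteq> f ` ball p (\<eta> / 2)" using \<rho> p(1) D(1) by blast
    also have "\<dots> \<subseteq> f ` ball x \<eta>"
    proof (intro image_mono subsetI)
      fix v assume "v \<in> ball p (\<eta> / 2)"
      then show "v \<in> ball x \<eta>"
        using p(2) dist_triangle[of x v p] by (simp add: dist_commute)
    qed
    finally show ?thesis .
  qed
  ultimately show thesis using that by blast
qed

text \<open>Uniform openness provides, near every point \<open>x\<close> of \<open>S\<close>, preimages of the points near \<open>f x\<close>, and
  expansion makes this local inverse contract by \<open>1 / \<mu>\<close>. Pulling a point back along a
  \<open>\<delta>\<close>-chain turns a distance \<open>< r\<close> into one \<open>< (\<delta> + r) / \<mu>\<close>, which is \<open>\<le> r\<close> for
  \<open>\<delta> \<le> (\<mu> - 1) * r\<close>. So the errors never accumulate. As the pulled back points need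
  not lie in \<open>S\<close>, the expansion estimate is used with only one of its two points in \<open>S\<close>.\<close>

lemma expanding_open_imp_ball_h_shadowing:
  fixes f :: "'a::metric_space \<Rightarrow> 'a"
  assumes "compact S" "continuous_on UNIV f" "expanding_on f S" "open_map_at_points f S"
  shows "ball_h_shadowing_on f S"
  unfolding ball_h_shadowing_on_def
proof (intro allI impI)
  fix \<epsilon> :: real assume \<epsilon>: "\<epsilon> > 0"
  obtain d \<mu> where d: "d > 0" and \<mu>: "\<mu> > 1"
    and expand: "\<And>x y. x \<in> S \<Longrightarrow> dist x y < d \<Longrightarrow> dist (f x) (f y) \<ge> \<mu> * dist x y"
    using assms(3) unfolding expanding_on_def by metis
  obtain \<rho> where \<rho>: "\<rho> > 0" "\<And>x. x \<in> S \<Longrightarrow> ball (f x) \<rho> \<subseteq> f ` ball x d"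
    using open_map_at_points_uniform[OF assms(1,2,4) d] by blast
  define r where "r = min \<epsilon> (\<rho> / 2)"
  define \<delta> where "\<delta> = min (\<rho> / 2) ((\<mu> - 1) * r)"
  have r: "r > 0" "r \<le> \<epsilon>" "\<delta> > 0" "\<delta> + r \<le> \<rho>" "\<delta> + r \<le> \<mu> * r"
    using \<epsilon> \<rho>(1) \<mu> by (auto simp: r_def \<delta>_def algebra_simps)
  have pull_back: "\<exists>w. f w = v \<and> dist w x < r"
    if "x \<in> S" "dist (f x) x' < \<delta>" "dist v x' < r" for x x' v
  proof -
    have v: "dist (f x) v < \<delta> + r"
      using that dist_triangle[of "f x" v x'] by (simp add: dist_commute)
    then have "v \<in> ball (f x) \<rho>" using r(4) by simp
    then obtain w where w: "f w = v" "dist x w < d"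
      using \<rho>(2) \<open>x \<in> S\<close> by (metis (no_types, lifting) imageE mem_ball subsetD)
    then have "\<mu> * dist x w < \<mu> * r"
      using expand[OF that(1) w(2)] v r(5) by simp
    then show ?thesis using w(1) \<mu> by (auto simp: dist_commute)
  qed
  have "tracks_into_ball f m c \<epsilon> r"
    if "finite_pseudo_orbit f \<delta> m c" "\<forall>i\<le>m. c i \<in> S" for m c
    using that
  proof (induction m)
    case 0
    then show ?case by (simp add: tracks_into_ball_def)
  next
    case (Suc m)
    then have IH: "tracks_into_ball f m c \<epsilon> r" by (simp add: finite_pseudo_orbit_def)
    show ?case
      unfolding tracks_into_ball_def
    proof (intro allI impI)
      fix v assume "dist v (c (Suc m)) < r"
      then obtain u where u: "f u = v" "dist u (c m) < r"
        using pull_back[of "c m" "c (Suc m)" v] Suc.prems by (auto simp: finite_pseudo_orbit_def)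
      then obtain w where "(f ^^ m) w = u" "\<forall>i<m. dist ((f ^^ i) w) (c i) < \<epsilon>"
        using IH unfolding tracks_into_ball_def by blast
      then show "\<exists>w. (f ^^ Suc m) w = v \<and> (\<forall>i<Suc m. dist ((f ^^ i) w) (c i) < \<epsilon>)"
        using u r(2) by (intro exI[of _ w]) (auto simp: less_Suc_eq)
    qed
  qed
  then show "\<exists>\<delta>>0. \<forall>m c. finite_pseudo_orbit f \<delta> m c \<and> (\<forall>i\<le>m. c i \<in> S) \<longrightarrow>
      (\<exists>\<eta>>0. tracks_into_ball f m c \<epsilon> \<eta>)"
    using r(1,3) by blast
qed

lemma open_map_at_points_iterate:
  assumes "\<forall>i<m. (f ^^ i) y \<in> W" "open_map_at_points f W" "y \<in> interior U"
  shows "(f ^^ m) y \<in> interior ((f ^^ m) ` U)"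
  using assms(1)
proof (induction m)
  case (Suc m)
  then have "(f ^^ m) y \<in> interior ((f ^^ m) ` U)" "(f ^^ m) y \<in> W" by simp_all
  then have "f ((f ^^ m) y) \<in> interior (f ` (f ^^ m) ` U)"
    using assms(2) unfolding open_map_at_points_def by blast
  then show ?case by (simp add: image_image)
qed (use assms(3) in simp)

text \<open>Take a point \<open>y\<close> that h-shadows the chain so closely that its orbit stays where \<open>f\<close> is open. Then
  \<open>f ^^ m\<close> is open at \<open>y\<close>, so the points that follow the orbit of \<open>y\<close> for \<open>m\<close> steps are mapped
  by \<open>f ^^ m\<close> onto a neighbourhood of the end of the chain.\<close>

lemma h_shadowing_open_imp_ball_h_shadowing:
  fixes f :: "'a::metric_space \<Rightarrow> 'a"
  assumes "compact S" "continuous_on UNIV f" "h_shadowing_on f S" "open_map_near f S"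
  shows "ball_h_shadowing_on f S"
  unfolding ball_h_shadowing_on_def
proof (intro allI impI)
  fix \<epsilon> :: real assume \<epsilon>: "\<epsilon> > 0"
  obtain W where W: "open W" "S \<subseteq> W" "open_map_at_points f W"
    using assms(4) unfolding open_map_near_def by blast
  obtain e where e: "e > 0" "(\<Union>x\<in>S. ball x e) \<subseteq> W"
    using compact_subset_open_imp_ball_epsilon_subset[OF assms(1) W(1,2)] by blast
  define \<epsilon>' where "\<epsilon>' = min e (\<epsilon> / 2)"
  have "\<epsilon>' > 0" using e(1) \<epsilon> by (simp add: \<epsilon>'_def)
  then obtain \<delta> where \<delta>: "\<delta> > 0"
    "\<And>m c. finite_pseudo_orbit f \<delta> m c \<Longrightarrow> \<forall>i\<le>m. c i \<in> S \<Longrightarrow>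
        \<exists>y. (\<forall>i<m. dist ((f ^^ i) y) (c i) < \<epsilon>') \<and> (f ^^ m) y = c m"
    using assms(3) unfolding h_shadowing_on_def by metis
  have "\<exists>\<eta>>0. tracks_into_ball f m c \<epsilon> \<eta>"
    if c: "finite_pseudo_orbit f \<delta> m c" "\<forall>i\<le>m. c i \<in> S" for m c
  proof -
    obtain y where y: "\<And>i. i < m \<Longrightarrow> dist ((f ^^ i) y) (c i) < \<epsilon>'" "(f ^^ m) y = c m"
      using \<delta>(2)[OF c] by blast
    define U where "U = (\<Inter>i\<in>{..<m}. (f ^^ i) -` ball ((f ^^ i) y) (\<epsilon> / 2))"
    have "open U"
      unfolding U_def using continuous_on_iterate[OF assms(2)]
      by (intro open_INT ballI finite_lessThan open_vimage open_ball) auto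
    moreover have "y \<in> U" using \<epsilon> by (simp add: U_def)
    ultimately have "y \<in> interior U" by (simp add: interior_open)
    moreover have "\<forall>i<m. (f ^^ i) y \<in> W"
    proof (intro allI impI)
      fix i assume i: "i < m"
      then have "(f ^^ i) y \<in> ball (c i) e" using y(1)[OF i] by (simp add: \<epsilon>'_def dist_commute)
      then show "(f ^^ i) y \<in> W" using e(2) c(2) i by (meson UN_I less_imp_le subsetD)
    qed
    ultimately have "c m \<in> interior ((f ^^ m) ` U)"
      using open_map_at_points_iterate[OF _ W(3)] y(2) by metis
    then obtain \<eta> where \<eta>: "\<eta> > 0" "ball (c m) \<eta> \<subseteq> (f ^^ m) ` U" by (auto simp: mem_interior)
    have "tracks_into_ball f m c \<epsilon> \<eta>"
      unfolding tracks_into_ball_def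
    proof (intro allI impI)
      fix v assume "dist v (c m) < \<eta>"
      then obtain w where w: "w \<in> U" "(f ^^ m) w = v" using \<eta>(2) by (fastforce simp: dist_commute)
      have "dist ((f ^^ i) w) (c i) < \<epsilon>" if i: "i < m" for i
      proof -
        have "dist ((f ^^ i) y) ((f ^^ i) w) < \<epsilon> / 2" using w(1) i by (simp add: U_def)
        moreover have "dist ((f ^^ i) y) (c i) < \<epsilon> / 2" using y(1)[OF i] by (simp add: \<epsilon>'_def)
        ultimately show ?thesis by (metis dist_triangle_half_r)
      qed
      then show "\<exists>w. (f ^^ m) w = v \<and> (\<forall>i<m. dist ((f ^^ i) w) (c i) < \<epsilon>)" using w(2) by blast
    qed
    then show ?thesis using \<eta>(1) by blast
  qed
  then show "\<exists>\<delta>>0. \<forall>m c. finite_pseudo_orbit f \<delta> m c \<and> (\<forall>i\<le>m. c i \<in> S) \<longrightarrow>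
      (\<exists>\<eta>>0. tracks_into_ball f m c \<epsilon> \<eta>)"
    using \<delta>(1) by blast
qed

text \<open>The hypothesis \<open>fit\<close> says that whatever follows chain \<open>Suc k\<close> starts in the ball of endpoints
  that can be reached along chain \<open>k\<close>. Hence finitely many chains can be followed by pulling back
  from the last one, and the closed sets \<open>F K\<close> of points that follow the first \<open>K\<close> chains have a
  common point.\<close>

lemma tracks_chain_sequence:
  fixes f :: "'a::metric_space \<Rightarrow> 'a"
  assumes cpt: "compact (UNIV :: 'a set)" and cont: "continuous_on UNIV f"
    and m: "\<And>k. m k \<ge> (1::nat)" and glue: "\<And>k. c k (m k) = c (Suc k) 0"
    and pos: "\<And>k. \<epsilon> k > 0" and fit: "\<And>k. \<epsilon> (Suc k) \<le> \<eta> k"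
    and tracks: "\<And>k. tracks_into_ball f (m k) (c k) (\<epsilon> k) (\<eta> k)"
  obtains y where "\<And>k i. i < m k \<Longrightarrow> dist ((f ^^ ((\<Sum>j<k. m j) + i)) y) (c k i) \<le> \<epsilon> k"
proof -
  define S where "S k = (\<Sum>j<k. m j)" for k
  have S_Suc: "S (Suc k) = S k + m k" for k by (simp add: S_def)
  have finite_tracking: "\<exists>w. (f ^^ S K) w = v \<and>
      (\<forall>k<K. \<forall>i<m k. dist ((f ^^ (S k + i)) w) (c k i) < \<epsilon> k)"
    if "dist v (c K 0) < \<epsilon> K" for K v
    using that
  proof (induction K arbitrary: v)
    case 0
    then show ?case by (simp add: S_def)
  next
    case (Suc K)
    then have "dist v (c K (m K)) < \<eta> K" using fit[of K] glue[of K] by simp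
    then obtain u where u: "(f ^^ m K) u = v" "\<And>i. i < m K \<Longrightarrow> dist ((f ^^ i) u) (c K i) < \<epsilon> K"
      using tracks[of K] unfolding tracks_into_ball_def by blast
    have "dist u (c K 0) < \<epsilon> K" using u(2)[of 0] m[of K] by simp
    then obtain w where w: "(f ^^ S K) w = u"
        "\<forall>k<K. \<forall>i<m k. dist ((f ^^ (S k + i)) w) (c k i) < \<epsilon> k"
      using Suc.IH by blast
    have shift: "(f ^^ (S K + i)) w = (f ^^ i) u" for i
      using w(1) by (metis add.commute comp_apply funpow_add)
    show ?case
    proof (intro exI conjI allI impI)
      show "(f ^^ S (Suc K)) w = v" using u(1) shift by (simp add: S_Suc)
      fix k i assume "k < Suc K" "i < m k"
      then show "dist ((f ^^ (S k + i)) w) (c k i) < \<epsilon> k"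
        using w(2) u(2) shift by (cases "k = K") auto
    qed
  qed
  define F where
    "F K = (\<Inter>k\<in>{..<K}. \<Inter>i\<in>{..<m k}. (f ^^ (S k + i)) -` cball (c k i) (\<epsilon> k))" for K
  have "closed (F K)" for K
    unfolding F_def using continuous_on_iterate[OF cont]
    by (intro closed_INT ballI closed_vimage closed_cball) auto
  moreover have "F K \<noteq> {}" for K
  proof -
    obtain w where "\<forall>k<K. \<forall>i<m k. dist ((f ^^ (S k + i)) w) (c k i) < \<epsilon> k"
      using finite_tracking[of "c K 0" K] pos[of K] by auto
    then have "w \<in> F K" by (simp add: F_def dist_commute less_imp_le)
    then show ?thesis by blast
  qed
  moreover have "F (Suc K) \<subseteq> F K" for K by (auto simp: F_def)
  ultimately obtain y where y: "\<And>K. y \<in> F K"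
    using nested_closed_sets_meet[OF cpt, of F] by blast
  have "dist ((f ^^ (S k + i)) y) (c k i) \<le> \<epsilon> k" if "i < m k" for k i
    using y[of "Suc k"] that by (auto simp: F_def dist_commute)
  then show thesis using that unfolding S_def by blast
qed

lemma internally_chain_transitive_ball_h_shadowing_omega_limit:
  fixes f :: "'a::metric_space \<Rightarrow> 'a"
  assumes cpt: "compact (UNIV :: 'a set)" and cont: "continuous_on UNIV f"
    and "closed A" "A \<noteq> {}" "A \<subseteq> S" and ict: "internally_chain_transitive f A"
    and shad: "ball_h_shadowing_on f S"
  obtains y where "A = omega_limit f y"
proof -
  have "compact A" using cpt \<open>closed A\<close> by (metis compact_Int_closed inf_top_left)
  obtain z :: "nat \<Rightarrow> 'a" where z: "range z \<subseteq> A"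
      "\<forall>a\<in>A. \<forall>\<epsilon>>0. \<forall>N. \<exists>n\<ge>N. dist (z n) a < \<epsilon>"
    using compact_recurrent_dense_sequence[OF \<open>compact A\<close> \<open>A \<noteq> {}\<close>]
    by blast
  have link: "\<exists>m c \<eta>. m \<ge> 1 \<and> c 0 = z k \<and> c m = z (Suc k) \<and> (\<forall>i\<le>m. c i \<in> A) \<and> \<eta> > 0 \<and>
      tracks_into_ball f m c \<epsilon> \<eta>" if "\<epsilon> > 0" for k \<epsilon>
  proof -
    obtain \<delta> where \<delta>: "\<delta> > 0" "\<And>m c. finite_pseudo_orbit f \<delta> m c \<Longrightarrow> \<forall>i\<le>m. c i \<in> S \<Longrightarrow>
        \<exists>\<eta>>0. tracks_into_ball f m c \<epsilon> \<eta>"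
      using shad \<open>\<epsilon> > 0\<close> unfolding ball_h_shadowing_on_def by metis
    have "z k \<in> A" "z (Suc k) \<in> A" using z(1) by auto
    then obtain m c where mc: "m \<ge> 1" "finite_pseudo_orbit f \<delta> m c" "c 0 = z k"
        "c m = z (Suc k)" "\<forall>i\<le>m. c i \<in> A"
      using ict \<delta>(1) unfolding internally_chain_transitive_def by metis
    then show ?thesis using \<delta>(2)[OF mc(2)] \<open>A \<subseteq> S\<close> by blast
  qed
  \<comment> \<open>A state consists of the length and the points of chain \<open>k\<close>, its tracking accuracy and the
      radius of its ball of endpoints. The accuracy of a chain is chosen only after the radius of
      the preceding one, as \<open>Q\<close> demands.\<close>
  define P where "P k = (\<lambda>(m, c, \<epsilon>, \<eta>). m \<ge> (1::nat) \<and> c 0 = z k \<and> c m = z (Suc k) \<and>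
      (\<forall>i\<le>m. c i \<in> A) \<and> \<epsilon> > 0 \<and> \<epsilon> \<le> 1 / Suc k \<and> \<eta> > 0 \<and> tracks_into_ball f m c \<epsilon> \<eta>)" for k
  define Q :: "nat \<times> (nat \<Rightarrow> 'a) \<times> real \<times> real \<Rightarrow> nat \<times> (nat \<Rightarrow> 'a) \<times> real \<times> real \<Rightarrow> bool"
    where "Q = (\<lambda>(_, _, _, \<eta>) (_, _, \<epsilon>', _). \<epsilon>' \<le> \<eta>)"
  have "\<exists>s. \<forall>k. P k (s k) \<and> Q (s k) (s (Suc k))"
  proof (rule dependent_nat_choice)
    obtain m c \<eta> where "P 0 (m, c, 1, \<eta>)"
      using link[of 1 0] by (auto simp: P_def)
    then show "\<exists>s. P 0 s" ..
  next
    fix s k assume s: "P k s"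
    obtain m c \<epsilon> \<eta> where s_eq: "s = (m, c, \<epsilon>, \<eta>)" by (cases s) auto
    have "min \<eta> (1 / Suc (Suc k)) > 0" using s by (simp add: P_def s_eq)
    from link[OF this, of "Suc k"] obtain m' c' \<eta>' where
      "P (Suc k) (m', c', min \<eta> (1 / Suc (Suc k)), \<eta>')"
      unfolding P_def using \<open>min \<eta> (1 / Suc (Suc k)) > 0\<close> by auto
    then show "\<exists>s'. P (Suc k) s' \<and> Q s s'"
      by (intro exI[of _ "(m', c', min \<eta> (1 / Suc (Suc k)), \<eta>')"]) (simp add: Q_def s_eq)
  qed
  then obtain s where s: "\<And>k. P k (s k)" "\<And>k. Q (s k) (s (Suc k))" by blast
  define m c \<epsilon> \<eta> where "m k = fst (s k)" and "c k = fst (snd (s k))"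
    and "\<epsilon> k = fst (snd (snd (s k)))" and "\<eta> k = snd (snd (snd (s k)))" for k
  have mc: "\<And>k. m k \<ge> 1" "\<And>k. c k 0 = z k" "\<And>k. c k (m k) = z (Suc k)"
      "\<And>k. \<forall>i\<le>m k. c k i \<in> A" "\<And>k. \<epsilon> k > 0" "\<And>k. \<epsilon> k \<le> 1 / Suc k"
      "\<And>k. tracks_into_ball f (m k) (c k) (\<epsilon> k) (\<eta> k)"
    using s(1) by (auto simp: P_def m_def c_def \<epsilon>_def \<eta>_def case_prod_beta)
  have fit: "\<epsilon> (Suc k) \<le> \<eta> k" for k
    using s(2)[of k] by (auto simp: Q_def \<epsilon>_def \<eta>_def case_prod_beta)
  have glue: "c k (m k) = c (Suc k) 0" for k by (simp add: mc)
  obtain y where y: "\<And>k i. i < m k \<Longrightarrow> dist ((f ^^ ((\<Sum>j<k. m j) + i)) y) (c k i) \<le> \<epsilon> k"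
    using tracks_chain_sequence[where m=m and c=c and \<epsilon>=\<epsilon> and \<eta>=\<eta>,
        OF cpt cont mc(1) glue mc(5) fit mc(7)] by metis
  obtain x where x: "\<And>k i. i \<le> m k \<Longrightarrow> x ((\<Sum>j<k. m j) + i) = c k i"
      "\<And>n. \<exists>k i. i < m k \<and> n = (\<Sum>j<k. m j) + i"
    using concatenate_chains[of m c] mc(1) glue by metis
  have range: "range x \<subseteq> A"
  proof (rule image_subsetI)
    fix n show "x n \<in> A" using x(2)[of n] x(1) mc(4) by (metis less_imp_le)
  qed
  have "(\<lambda>n. dist ((f ^^ n) y) (x n)) \<longlonglongrightarrow> 0"
    unfolding lim_sequentially
  proof (intro allI impI)
    fix e :: real assume "e > 0"
    then obtain K :: nat where K: "1 / Suc K < e" using nat_approx_posE by blast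
    have "dist ((f ^^ n) y) (x n) < e" if n: "n \<ge> (\<Sum>j<K. m j)" for n
    proof -
      obtain k i where ki: "i < m k" "n = (\<Sum>j<k. m j) + i" using x(2) by blast
      then have "K \<le> k" using concatenated_chain_late_block n by blast
      have "dist ((f ^^ n) y) (x n) \<le> \<epsilon> k" using y[of i k] x(1)[of i k] ki by simp
      also have "\<dots> \<le> 1 / Suc k" by (rule mc(6))
      also have "\<dots> \<le> 1 / Suc K" using \<open>K \<le> k\<close> by (simp add: frac_le)
      finally show ?thesis using K by simp
    qed
    then show "\<exists>N. \<forall>n\<ge>N. dist (dist ((f ^^ n) y) (x n)) 0 < e" by auto
  qed
  then have "omega_limit f y = A"
  proof (rule omega_limit_eq_if_tracked[OF _ \<open>closed A\<close> range])
    fix a N and e :: real assume "a \<in> A" "e > 0"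
    then obtain k where k: "k \<ge> N" "dist (z k) a < e" using z(2) by blast
    have "x (\<Sum>j<k. m j) = z k" using x(1)[of 0 k] mc(2) by simp
    moreover have "k \<le> (\<Sum>j<k. m j)" using sum_bounded_below[of "{..<k}" 1 m] mc(1) by simp
    ultimately show "\<exists>n\<ge>N. dist (x n) a < e" using k by (metis order_trans)
  qed
  then show thesis using that by blast
qed

section \<open>The equivalence\<close>

theorem theorem1p1:
  fixes f :: "'a::metric_space \<Rightarrow> 'a" and \<Lambda> A :: "'a set"
  assumes "compact (UNIV :: 'a set)"
    and "closed \<Lambda>"
    and "continuous_on UNIV f"
    and "limit_shadowing_on f \<Lambda>
       \<or> topologically_hyperbolic f
       \<or> (expanding_on f \<Lambda> \<and> open_map_at_points f \<Lambda>)
       \<or> (h_shadowing_on f \<Lambda> \<and> open_map_near f \<Lambda>)"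
    and "A \<noteq> {}" and "closed A" and "A \<subseteq> \<Lambda>"
  shows "((\<forall>p. A = {p} \<longrightarrow> f p = p) \<longrightarrow>
            weakly_incompressible f A \<longrightarrow> internally_chain_transitive f A)
       \<and> (internally_chain_transitive f A \<longrightarrow> weakly_incompressible f A)
       \<and> (internally_chain_transitive f A \<longleftrightarrow> (\<exists>x. A = omega_limit f x))"
proof -
  have compact: "compact B" if "closed B" for B :: "'a set"
    using assms(1) that by (metis compact_Int_closed inf_top_left)
  have "\<exists>x. A = omega_limit f x" if ict: "internally_chain_transitive f A"
  proof -
    have "limit_shadowing_on f A \<or> ball_h_shadowing_on f \<Lambda>"
      using assms(4)
    proof (elim disjE conjE)
      assume "limit_shadowing_on f \<Lambda>"
      then show ?thesis using assms(7) unfolding limit_shadowing_on_def by blast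
    qed (use topologically_hyperbolic_imp_limit_shadowing[OF assms(1,3)]
        expanding_open_imp_ball_h_shadowing[OF compact[OF assms(2)] assms(3)]
        h_shadowing_open_imp_ball_h_shadowing[OF compact[OF assms(2)] assms(3)] in blast)+
    then show ?thesis
      using internally_chain_transitive_limit_shadowing_omega_limit[OF compact[OF assms(6)] assms(5) ict]
        internally_chain_transitive_ball_h_shadowing_omega_limit[OF assms(1,3,6,5,7) ict]
      by metis
  qed
  then show ?thesis
    using weakly_incompressible_imp_internally_chain_transitive[OF assms(3,6)]
      internally_chain_transitive_imp_weakly_incompressible[OF compact[OF assms(6)]]
      omega_limit_internally_chain_transitive[OF assms(1,3)]
    by blast
qed

end
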